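(* For any nonnegative integer $n$, $F_3(n)=\overline{p}_{4,2}(n,\text{blue})$.
   Context: A two-color partition of $n$ is a finite multiset of positive integers (parts), each part colored red or blue, whose sum is $n$ (the same integer in two different colors counts as two different kinds of parts). For a nonnegative integer $n$, $\mathcal{F}(n)$ is the set of two-color partitions of $n$ in which even parts may occur only in blue color (odd parts may occur in either color; repetitions are allowed). $F_3(n)$ is the number of partitions in $\mathcal{F}(n)$ in which the number of even parts (counted with multiplicity) is odd. For $\pi\in\mathcal{F}(n)$, $\operatorname{mex}_{4,2}(\pi,\text{blue})$ is the smallest positive integer $\equiv 2\pmod 4$ that is not a part of $\pi$ (such parts can occur only in blue). $\overline{p}_{4,2}(n,\text{blue})$ is the number of partitions $\pi\in\mathcal{F}(n)$ with $\operatorname{mex}_{4,2}(\pi,\text{blue})\equiv 6\pmod 8$. *)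

theory Defs
  imports Main "HOL-Library.Multiset"
begin

datatype color = Red | Blue

text \<open>A part is a pair of its size and its color.\<close>

type_synonym two_color_partition = "(nat \<times> color) multiset"

definition two_color_partitions :: "nat \<Rightarrow> two_color_partition set" where
  "two_color_partitions n =
     {\<pi>. (\<forall>p \<in># \<pi>. 0 < fst p) \<and> (\<Sum>p \<in># \<pi>. fst p) = n}"

definition even_blue_partitions :: "nat \<Rightarrow> two_color_partition set" where
  "even_blue_partitions n =
     {\<pi> \<in> two_color_partitions n. \<forall>p \<in># \<pi>. even (fst p) \<longrightarrow> snd p = Blue}"

definition F3 :: "nat \<Rightarrow> nat" where
  "F3 n = card {\<pi> \<in> even_blue_partitions n. odd (size {#p \<in># \<pi>. even (fst p)#})}"

definition mex :: "nat \<Rightarrow> nat \<Rightarrow> two_color_partition \<Rightarrow> color \<Rightarrow> nat" where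
  "mex A a \<pi> c = (LEAST m. 0 < m \<and> m mod A = a mod A \<and> (m, c) \<notin># \<pi>)"

definition pbar42_blue :: "nat \<Rightarrow> nat" where
  "pbar42_blue n = card {\<pi> \<in> even_blue_partitions n. mex 4 2 \<pi> Blue mod 8 = 6}"

text \<open>
  The two facts below confirm that \<^const>\<open>card\<close> is applied to finite sets only, and that the
  set minimized over in \<^const>\<open>mex\<close> is never empty.
\<close>

lemma finite_two_color_partitions: "finite (two_color_partitions n)"
proof -
  let ?B = "{..n} \<times> {Red, Blue}"
  have "two_color_partitions n \<subseteq> (\<Union>k\<le>n. multisets_of_size ?B k)"
  proof
    fix \<pi> assume "\<pi> \<in> two_color_partitions n"
    then have pos: "\<forall>p \<in># \<pi>. 0 < fst p" and s: "(\<Sum>p \<in># \<pi>. fst p) = n"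
      by (auto simp: two_color_partitions_def)
    have "(\<Sum>p \<in># \<pi>. 1) \<le> (\<Sum>p \<in># \<pi>. fst p)"
      by (rule sum_mset_mono) (use pos in \<open>auto simp: Suc_le_eq\<close>)
    then have "size \<pi> \<le> n"
      unfolding s by simp
    moreover have "p \<in> ?B" if "p \<in># \<pi>" for p
    proof -
      have "fst p \<le> n"
        using multi_member_split[OF that] unfolding s[symmetric] by force
      then show ?thesis
        by (cases p) (use color.exhaust in auto)
    qed
    ultimately have "size \<pi> \<in> {..n}" "\<pi> \<in> multisets_of_size ?B (size \<pi>)"
      unfolding multisets_of_size_def by auto
    then show "\<pi> \<in> (\<Union>k\<le>n. multisets_of_size ?B k)"
      by (rule UN_I)
  qed
  then show ?thesis
    by (rule finite_subset) (intro finite_UN_I finite_multisets_of_size, simp_all)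
qed

lemma mex_exists:
  fixes A a :: nat
  assumes "0 < A"
  shows "\<exists>m. 0 < m \<and> m mod A = a mod A \<and> (m, c) \<notin># \<pi>"
proof -
  define f where "f k = a + A * Suc k" for k
  have "inj f"
    using assms by (intro injI) (simp add: f_def)
  then have "infinite (range f)"
    by (simp add: finite_image_iff)
  then obtain m where "m \<in> range f" "m \<notin> fst ` set_mset \<pi>"
    using finite_subset[of "range f" "fst ` set_mset \<pi>"] by auto
  then obtain k where k: "m = a + A * Suc k"
    by (auto simp: f_def)
  have "(m, c) \<notin># \<pi>"
    using \<open>m \<notin> fst ` set_mset \<pi>\<close> by (metis fst_conv image_eqI)
  moreover have "0 < m"
    using assms by (simp add: k)
  moreover have "m mod A = a mod A"
    unfolding k by (rule mod_mult_self2)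
  ultimately show ?thesis by blast
qed

end

theory Submission
  imports Defs "HOL-Computational_Algebra.Formal_Power_Series"
begin

text \<open>
  Let \<open>F(n)\<close> be the number of partitions of \<open>n\<close> under consideration, let \<open>P\<close> be the
  generating function of \<open>F\<close>, and let \<open>Q\<close> be the one in which a partition counts with the
  sign \<open>(-1)\<close> raised to the number of its even parts. Both sides of the theorem turn out to measure the
  difference between \<open>P\<close> and \<open>Q\<close>.

  On the side of the mex, the value \<open>4 k + 2\<close> means that the blue parts \<open>2, 6, \<dots>, 4 k - 2\<close>
  all occur and the next one does not. It is \<open>6\<close> modulo \<open>8\<close> exactly for odd \<open>k\<close>, and then
  \<open>1 - 1 + 1 - \<dots>\<close> with \<open>k\<close> terms is \<open>1\<close>; for even \<open>k\<close> it is \<open>0\<close>. The partitions that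
  contain the first \<open>j\<close> of these parts become arbitrary ones of \<open>n - 2 j\<^sup>2\<close> when one copy of
  each is taken away, so that
  \<open>pbar42_blue n = F(n - 2) - F(n - 8) + F(n - 18) - \<dots>\<close> (lemma \<open>pbar_alternating_sum\<close>).

  On the side of the parity, \<open>2 F3 n\<close> is the coefficient of \<open>P - Q\<close>. Hence the
  theorem amounts to \<open>Q = (1 - 2 x\<^sup>2 + 2 x\<^sup>8 - 2 x\<^bsup>18\<^esup> + \<dots>) P\<close>. The odd parts contribute
  the same factor to \<open>P\<close> and to \<open>Q\<close>, and an even part \<open>2 i\<close> contributes \<open>1 / (1 - q\<^sup>i)\<close>
  and \<open>1 / (1 + q\<^sup>i)\<close> respectively, where \<open>q = x\<^sup>2\<close>. What remains is Gauss's identity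
  \<open>\<Prod>\<^sub>i (1 - q\<^sup>i) / (1 + q\<^sup>i) = 1 - 2 q + 2 q\<^sup>4 - 2 q\<^sup>9 + \<dots>\<close>.

  That identity is obtained from a finite form, \<open>finite_Gauss_theta\<close>, which has a Gaussian
  binomial coefficient as an extra factor of each term and follows by induction from Pascal's
  rule. Only finitely many coefficients matter for a given \<open>n\<close>, so infinite products are replaced
  by congruences modulo a power of \<open>q\<close>: \<open>Gauss_theta_mod\<close> for the identity, \<open>signed_gf_mod\<close>
  for the generating functions of partitions into parts of bounded size.
\<close>

section \<open>Gaussian binomial coefficients\<close>

fun qbinom :: "'a::comm_ring_1 \<Rightarrow> nat \<Rightarrow> nat \<Rightarrow> 'a" where
  "qbinom q n 0 = 1"
| "qbinom q 0 (Suc k) = 0"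
| "qbinom q (Suc n) (Suc k) = q ^ Suc k * qbinom q n (Suc k) + qbinom q n k"

lemma qbinom_eq_0: "n < k \<Longrightarrow> qbinom q n k = 0"
  by (induction q n k rule: qbinom.induct) auto

lemma qbinom_dual_Pascal:
  "k \<le> n \<Longrightarrow> qbinom q (Suc n) (Suc k) = qbinom q n (Suc k) + q ^ (n - k) * qbinom q n k"
proof (induction n arbitrary: k)
  case 0
  then show ?case by simp
next
  case (Suc n)
  show ?case
  proof (cases k)
    case 0
    then show ?thesis
      using Suc.IH[of 0] by (simp add: algebra_simps)
  next
    case k: (Suc l)
    then have l: "l \<le> n" using Suc.prems by simp
    have lower: "qbinom q (Suc n) k = qbinom q n k + q ^ (n - l) * qbinom q n l"
      using Suc.IH[OF l] by (simp only: k)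
    show ?thesis
    proof (cases "k \<le> n")
      case True
      have "q ^ (n - l) * q ^ k = q ^ Suc k * q ^ (n - k)"
        using True k by (simp flip: power_add power_Suc)
      then have pow: "q ^ (n - l) * (q ^ k * x) = q ^ Suc k * (q ^ (n - k) * x)" for x
        by (simp only: mult.assoc[symmetric])
      have "qbinom q (Suc (Suc n)) (Suc k)
          = q ^ Suc k * (qbinom q n (Suc k) + q ^ (n - k) * qbinom q n k)
            + (qbinom q n k + q ^ (n - l) * qbinom q n l)"
        unfolding qbinom.simps(3)[of q "Suc n"] lower Suc.IH[OF True] ..
      also have "\<dots> = q ^ Suc k * qbinom q n (Suc k) + qbinom q n k
            + q ^ (n - l) * (q ^ k * qbinom q n k + qbinom q n l)"
        unfolding distrib_left pow by (simp only: ac_simps)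
      also have "\<dots> = qbinom q (Suc n) (Suc k) + q ^ (Suc n - k) * qbinom q (Suc n) k"
        by (simp add: k)
      finally show ?thesis .
    next
      case False
      then have "k = Suc n" using Suc.prems by simp
      then show ?thesis
        by (simp add: qbinom_eq_0)
    qed
  qed
qed

text \<open>
  The two Pascal rules express the same coefficient through the same two neighbours, so a suitable
  combination cancels one of these. This gives both absorption rules without any division, and
  hence over every commutative ring.
\<close>

lemma qbinom_absorb_lower:
  assumes "k \<le> n"
  shows "(1 - q ^ Suc k) * qbinom q (Suc n) (Suc k) = (1 - q ^ Suc n) * qbinom q n k"
proof -
  have pow: "q ^ Suc k * (q ^ (n - k) * x) = q ^ Suc n * x" for x
    using assms by (simp add: mult.assoc[symmetric] del: power_Suc flip: power_add)
  have "(1 - q ^ Suc k) * qbinom q (Suc n) (Suc k)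
      = (q ^ Suc k * qbinom q n (Suc k) + qbinom q n k)
        - q ^ Suc k * (qbinom q n (Suc k) + q ^ (n - k) * qbinom q n k)"
    unfolding left_diff_distrib qbinom_dual_Pascal[OF assms, symmetric] by simp
  also have "\<dots> = (1 - q ^ Suc n) * qbinom q n k"
    unfolding distrib_left pow by (simp add: algebra_simps)
  finally show ?thesis .
qed

lemma qbinom_absorb_upper:
  assumes "k \<le> n"
  shows "(1 - q ^ (Suc n - k)) * qbinom q (Suc n) k = (1 - q ^ Suc n) * qbinom q n k"
proof (cases k)
  case 0
  then show ?thesis by simp
next
  case k: (Suc l)
  then have l: "l \<le> n" using assms by simp
  have pow: "q ^ (n - l) * (q ^ Suc l * x) = q ^ Suc n * x" for x
    using l by (simp add: mult.assoc[symmetric] del: power_Suc flip: power_add)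
  have "(1 - q ^ (n - l)) * qbinom q (Suc n) (Suc l)
      = (qbinom q n (Suc l) + q ^ (n - l) * qbinom q n l)
        - q ^ (n - l) * (q ^ Suc l * qbinom q n (Suc l) + qbinom q n l)"
    unfolding left_diff_distrib qbinom_dual_Pascal[OF l, symmetric] by simp
  also have "\<dots> = (1 - q ^ Suc n) * qbinom q n (Suc l)"
    unfolding distrib_left pow by (simp add: algebra_simps)
  finally show ?thesis by (simp add: k)
qed

text \<open>The \<open>q\<close>-Pochhammer symbol \<open>(q; q)\<^sub>n\<close>, the \<open>q\<close>-analogue of the factorial.\<close>

definition qpoch :: "'a::comm_ring_1 \<Rightarrow> nat \<Rightarrow> 'a" where
  "qpoch q n = (\<Prod>i=1..n. 1 - q ^ i)"

lemma qpoch_split: "m \<le> n \<Longrightarrow> qpoch q n = qpoch q m * (\<Prod>i=Suc m..n. 1 - q ^ i)"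
  unfolding qpoch_def
  by (subst prod.union_disjoint[symmetric]) (auto intro!: prod.cong)

text \<open>
  Iterating an absorption rule clears one of the two factorials in the denominator of the
  coefficient. Both versions are stated because only the smaller factorial is useful below: what is
  left then has no factors \<open>1 - q\<^sup>i\<close> with small \<open>i\<close>.
\<close>

lemma qbinom_times_qpoch_lower:
  "k \<le> n \<Longrightarrow> qbinom q n k * qpoch q k = (\<Prod>i=Suc (n - k)..n. 1 - q ^ i)"
proof (induction k arbitrary: n)
  case 0
  then show ?case by (simp add: qpoch_def)
next
  case (Suc k)
  then obtain m where n: "n = Suc m" and km: "k \<le> m" by (cases n) auto
  have "qbinom q n (Suc k) * qpoch q (Suc k)
      = ((1 - q ^ Suc k) * qbinom q (Suc m) (Suc k)) * qpoch q k"
    by (simp add: qpoch_def n prod.nat_ivl_Suc' ac_simps del: qbinom.simps)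
  also have "\<dots> = (\<Prod>i=Suc (m - k)..m. 1 - q ^ i) * (1 - q ^ Suc m)"
    unfolding qbinom_absorb_lower[OF km] Suc.IH[OF km, symmetric] by (simp only: ac_simps)
  also have "\<dots> = (\<Prod>i=Suc (n - Suc k)..n. 1 - q ^ i)"
    using km by (simp add: n prod.nat_ivl_Suc')
  finally show ?case .
qed

lemma qbinom_times_qpoch_upper:
  "k \<le> n \<Longrightarrow> qbinom q n k * qpoch q (n - k) = (\<Prod>i=Suc k..n. 1 - q ^ i)"
proof (induction n)
  case 0
  then show ?case by (simp add: qpoch_def)
next
  case (Suc n)
  show ?case
  proof (cases "k \<le> n")
    case True
    then have "qbinom q (Suc n) k * qpoch q (Suc n - k)
        = ((1 - q ^ (Suc n - k)) * qbinom q (Suc n) k) * qpoch q (n - k)"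
      by (simp add: Suc_diff_le qpoch_def prod.nat_ivl_Suc' ac_simps)
    also have "\<dots> = (\<Prod>i=Suc k..n. 1 - q ^ i) * (1 - q ^ Suc n)"
      unfolding qbinom_absorb_upper[OF True] Suc.IH[OF True, symmetric] by (simp only: ac_simps)
    also have "\<dots> = (\<Prod>i=Suc k..Suc n. 1 - q ^ i)"
      using True by (simp add: prod.nat_ivl_Suc' ac_simps)
    finally show ?thesis .
  next
    case False
    then have k: "k = Suc n" using Suc.prems by simp
    have "qbinom q n n = 1" for n by (induction n) (auto simp: qbinom_eq_0)
    then show ?thesis by (simp only: k) (simp add: qpoch_def)
  qed
qed

section \<open>Gauss's theta identity\<close>

lemma qbinom_sum_Pascal:
  "(\<Sum>k\<le>Suc n. g k * qbinom q (Suc n) k) = (\<Sum>k\<le>n. (q ^ k * g k + g (Suc k)) * qbinom q n k)"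
proof -
  have "(\<Sum>k\<le>Suc n. g k * qbinom q (Suc n) k)
      = g 0 + (\<Sum>k\<le>n. g (Suc k) * (q ^ Suc k * qbinom q n (Suc k))) + (\<Sum>k\<le>n. g (Suc k) * qbinom q n k)"
    by (simp only: sum.atMost_Suc_shift qbinom.simps distrib_left sum.distrib) simp
  also have "g 0 + (\<Sum>k\<le>n. g (Suc k) * (q ^ Suc k * qbinom q n (Suc k)))
      = (\<Sum>k\<le>Suc n. q ^ k * g k * qbinom q n k)"
    by (simp only: sum.atMost_Suc_shift) (simp add: ac_simps)
  also have "\<dots> = (\<Sum>k\<le>n. q ^ k * g k * qbinom q n k)"
    by (simp add: qbinom_eq_0)
  finally show ?thesis
    by (simp add: sum.distrib distrib_right)
qed

text \<open>
  The square \<open>(k - n)\<^sup>2\<close> as an exponent. Sums over \<open>j = k - n\<close> from \<open>- n\<close> to \<open>n\<close> are indexed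
  by \<open>k\<close> from \<open>0\<close> to \<open>2 n\<close>, which fits the lower index of the Gaussian coefficients.
\<close>

definition sqdist :: "nat \<Rightarrow> nat \<Rightarrow> nat" where
  "sqdist k n = nat ((int k - int n)\<^sup>2)"

lemma int_sqdist: "int (sqdist k n) = (int k - int n)\<^sup>2"
  by (simp add: sqdist_def)

text \<open>
  This is Gauss's evaluation of the alternating sum of the Gaussian coefficients with upper index
  \<open>2 n\<close>, with \<open>1 / q\<close> in place of \<open>q\<close>. In the induction step, Pascal's rule lowers the upper index from
  \<open>2 n + 2\<close> to \<open>2 n + 1\<close>. The two contributions to the term for \<open>k\<close> then differ
  by the factor \<open>- q\<^bsup>2n+1-k\<^esup>\<close>, since \<open>k + (k - n - 1)\<^sup>2 = (k - n)\<^sup>2 + (2 n + 1 - k)\<close>. Their sum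
  therefore contains \<open>1 - q\<^bsup>2n+1-k\<^esup>\<close>, which absorption turns into \<open>1 - q\<^bsup>2n+1\<^esup>\<close> while it lowers the
  upper index to \<open>2 n\<close>.
\<close>

lemma finite_Gauss_theta:
  "(\<Sum>k\<le>2 * n. (- 1) ^ (k + n) * q ^ sqdist k n * qbinom q (2 * n) k) = (\<Prod>i<n. 1 - q ^ (2 * i + 1))"
proof (induction n)
  case 0
  then show ?case by (simp add: sqdist_def)
next
  case (Suc n)
  define m where "m = 2 * n"
  define s :: "nat \<Rightarrow> 'a" where "s k = (- 1) ^ (k + n) * q ^ sqdist k n" for k
  have step: "q ^ k * ((- 1) ^ (k + Suc n) * q ^ sqdist k (Suc n))
      + (- 1) ^ (Suc k + Suc n) * q ^ sqdist (Suc k) (Suc n) = s k * (1 - q ^ (Suc m - k))"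
    if "k \<le> Suc m" for k
  proof -
    have "int (k + sqdist k (Suc n)) = int (sqdist k n + (Suc m - k))"
      using that by (simp add: int_sqdist m_def of_nat_diff power2_eq_square algebra_simps)
    then have e: "k + sqdist k (Suc n) = sqdist k n + (Suc m - k)"
      by (simp only: of_nat_eq_iff)
    have e': "sqdist (Suc k) (Suc n) = sqdist k n"
      by (simp add: sqdist_def)
    have "q ^ k * ((- 1) ^ (k + Suc n) * q ^ sqdist k (Suc n))
        = - ((- 1) ^ (k + n) * q ^ (k + sqdist k (Suc n)))"
      by (simp add: power_add ac_simps)
    then show ?thesis
      unfolding e e' s_def by (simp add: power_add algebra_simps)
  qed
  have "(\<Sum>k\<le>2 * Suc n. (- 1) ^ (k + Suc n) * q ^ sqdist k (Suc n) * qbinom q (2 * Suc n) k)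
      = (\<Sum>k\<le>Suc (Suc m). (- 1) ^ (k + Suc n) * q ^ sqdist k (Suc n) * qbinom q (Suc (Suc m)) k)"
    by (simp only: m_def mult_Suc_right) simp
  also have "\<dots> = (\<Sum>k\<le>Suc m. (s k * (1 - q ^ (Suc m - k))) * qbinom q (Suc m) k)"
    by (subst qbinom_sum_Pascal) (intro sum.cong refl arg_cong2[of _ _ _ _ "(*)"] step, simp)
  \<comment> \<open>The top term is zero because of its factor \<open>1 - q\<^sup>0\<close>.\<close>
  also have "\<dots> = (\<Sum>k\<le>m. s k * ((1 - q ^ (Suc m - k)) * qbinom q (Suc m) k))"
    by (simp add: mult.assoc)
  also have "\<dots> = (\<Sum>k\<le>m. s k * ((1 - q ^ Suc m) * qbinom q m k))"
    by (intro sum.cong refl arg_cong2[of _ _ _ _ "(*)"] qbinom_absorb_upper) simp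
  also have "\<dots> = (\<Sum>k\<le>m. s k * qbinom q m k) * (1 - q ^ Suc m)"
    by (simp add: sum_distrib_left sum_distrib_right ac_simps)
  also have "\<dots> = (\<Prod>i<Suc n. 1 - q ^ (2 * i + 1))"
    using Suc.IH by (simp add: s_def m_def)
  finally show ?case .
qed

lemma power_dvd_prod_minus_one:
  fixes q :: "'a::comm_ring_1"
  assumes "\<And>i. i \<in> I \<Longrightarrow> m \<le> i"
  shows "q ^ m dvd (\<Prod>i\<in>I. 1 - q ^ i) - 1"
  using assms
proof (induction I rule: infinite_finite_induct)
  case (insert x I)
  have "(\<Prod>i\<in>insert x I. 1 - q ^ i) - 1
      = ((\<Prod>i\<in>I. 1 - q ^ i) - 1) - q ^ x * (\<Prod>i\<in>I. 1 - q ^ i)"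
    using insert.hyps by (simp add: algebra_simps)
  moreover have "q ^ m dvd q ^ x"
    using insert.prems by (intro le_imp_power_dvd) simp
  ultimately show ?case
    using insert by (metis dvd_diff dvd_mult2 insertCI)
qed auto

text \<open>
  Let \<open>j = |k - n|\<close>. After cancelling the smaller factorial, all factors \<open>1 - q\<^sup>i\<close> of the
  product have \<open>i > n - j\<close>, so that it is \<open>1\<close> modulo \<open>q\<^bsup>n+1-j\<^esup>\<close>. The power of \<open>q\<close> in front
  makes up for the missing \<open>j\<close>, because \<open>j\<^sup>2 \<ge> j\<close>. Thus every term of the finite identity
  has the expected limit with an error beyond \<open>q\<^sup>n\<close>, even where \<open>k\<close> is far from \<open>n\<close>.
\<close>

lemma qpoch_times_central_qbinom:
  fixes q :: "'a::comm_ring_1"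
  assumes "k \<le> 2 * n"
  shows "q ^ Suc n dvd q ^ sqdist k n * (qbinom q (2 * n) k * qpoch q n - 1)"
proof -
  define j where "j = nat \<bar>int k - int n\<bar>"
  have jn: "j \<le> n" using assms by (simp add: j_def)
  have sq: "sqdist k n = j * j"
    by (simp add: sqdist_def j_def power2_eq_square flip: nat_mult_distrib abs_mult)
  have "\<exists>I. qbinom q (2 * n) k * qpoch q n = (\<Prod>i\<in>I. 1 - q ^ i) \<and> (\<forall>i\<in>I. Suc n - j \<le> i)"
  proof (cases "k \<le> n")
    case True
    have "qbinom q (2 * n) k * qpoch q n
        = (\<Prod>i=Suc (2 * n - k)..2 * n. 1 - q ^ i) * (\<Prod>i=Suc k..n. 1 - q ^ i)"
      using qbinom_times_qpoch_lower[OF assms, of q] qpoch_split[OF True, of q]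
      by (simp add: mult.assoc[symmetric])
    also have "\<dots> = (\<Prod>i\<in>{Suc (2 * n - k)..2 * n} \<union> {Suc k..n}. 1 - q ^ i)"
      using True by (intro prod.union_disjoint[symmetric]) auto
    finally show ?thesis
      using True
      by (intro exI[of _ "{Suc (2 * n - k)..2 * n} \<union> {Suc k..n}"]) (auto simp: j_def)
  next
    case False
    have le: "2 * n - k \<le> n" using False by simp
    have "qbinom q (2 * n) k * qpoch q n
        = (\<Prod>i=Suc k..2 * n. 1 - q ^ i) * (\<Prod>i=Suc (2 * n - k)..n. 1 - q ^ i)"
      using qbinom_times_qpoch_upper[OF assms, of q] qpoch_split[OF le, of q]
      by (simp add: mult.assoc[symmetric])
    also have "\<dots> = (\<Prod>i\<in>{Suc k..2 * n} \<union> {Suc (2 * n - k)..n}. 1 - q ^ i)"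
      using False by (intro prod.union_disjoint[symmetric]) auto
    finally show ?thesis
      using False assms
      by (intro exI[of _ "{Suc k..2 * n} \<union> {Suc (2 * n - k)..n}"]) (auto simp: j_def)
  qed
  then have "q ^ (Suc n - j) dvd qbinom q (2 * n) k * qpoch q n - 1"
    using power_dvd_prod_minus_one by metis
  then have "q ^ (j * j + (Suc n - j)) dvd q ^ sqdist k n * (qbinom q (2 * n) k * qpoch q n - 1)"
    unfolding sq power_add by (rule mult_dvd_mono[OF dvd_refl])
  moreover have "Suc n \<le> j * j + (Suc n - j)"
    using jn le_square[of j] by linarith
  ultimately show ?thesis
    using le_imp_power_dvd dvd_trans by blast
qed

text \<open>A partial sum of the theta series \<open>\<Sum>\<^sub>j (-1)\<^sup>j q^(j * j)\<close> over all integers \<open>j\<close>.\<close>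

definition theta :: "'a::comm_ring_1 \<Rightarrow> nat \<Rightarrow> 'a" where
  "theta q n = 1 + 2 * (\<Sum>j=1..n. (- 1) ^ j * q ^ (j * j))"

lemma theta_centered:
  "theta q n = (\<Sum>k\<le>2 * n. (- 1) ^ (k + n) * q ^ sqdist k n)"
proof -
  define f :: "nat \<Rightarrow> 'a" where "f k = (- 1) ^ (k + n) * q ^ sqdist k n" for k
  define g :: "nat \<Rightarrow> 'a" where "g j = (- 1) ^ j * q ^ (j * j)" for j
  have up: "f (n + j) = g j" for j
  proof -
    have "sqdist (n + j) n = j * j"
      by (simp add: sqdist_def power2_eq_square flip: of_nat_mult)
    then show ?thesis by (simp add: f_def g_def uminus_power_if)
  qed
  have down: "f (n - j) = g j" if "j \<le> n" for j
  proof -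
    have "sqdist (n - j) n = j * j"
      using that by (simp add: sqdist_def power2_eq_square of_nat_diff flip: of_nat_mult)
    moreover have "even (n - j + n) = even j"
      using that by simp
    ultimately show ?thesis by (simp add: f_def g_def uminus_power_if del: even_add)
  qed
  have "{..2 * n} = {..<n} \<union> insert n {Suc n..2 * n}" by auto
  then have "sum f {..2 * n} = sum f {..<n} + (f n + sum f {Suc n..2 * n})"
    by (simp only:) (subst sum.union_disjoint, auto)
  also have "sum f {..<n} = sum g {1..n}"
    by (rule sum.reindex_bij_witness[of _ "\<lambda>j. n - j" "\<lambda>k. n - k"]) (auto simp flip: down)
  also have "sum f {Suc n..2 * n} = sum g {1..n}"
    by (rule sum.reindex_bij_witness[of _ "\<lambda>j. n + j" "\<lambda>k. k - n"]) (auto simp flip: up)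
  also have "f n = 1"
    using up[of 0] by (simp add: g_def)
  finally show ?thesis
    by (simp add: theta_def f_def g_def algebra_simps)
qed

text \<open>
  Euler's observation that, by \<open>1 - q\<^bsup>2i\<^esup> = (1 - q\<^sup>i) (1 + q\<^sup>i)\<close>, the product of all
  \<open>1 - q\<^sup>i\<close> with odd \<open>i\<close> is inverse to that of all \<open>1 + q\<^sup>i\<close>, in finite form.
\<close>

lemma qpoch_even_odd:
  "qpoch q (2 * n) = (\<Prod>i<n. 1 - q ^ (2 * i + 1)) * (qpoch q n * (\<Prod>i=1..n. 1 + q ^ i))"
proof (induction n)
  case 0
  then show ?case by (simp add: qpoch_def)
next
  case (Suc n)
  have "1 - q ^ (2 * Suc n) = (1 - q ^ Suc n) * (1 + q ^ Suc n)"
    by (simp add: algebra_simps flip: power_add mult_2)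
  then show ?case
    using Suc.IH by (simp add: qpoch_def prod.nat_ivl_Suc' ac_simps)
qed

text \<open>
  Write \<open>A\<close> for the right-hand side of \<open>finite_Gauss_theta\<close> and \<open>B\<close> for the product of the
  \<open>1 + q\<^sup>i\<close>. Modulo \<open>q\<^bsup>n+1\<^esup>\<close>, multiplying the finite identity by \<open>(q; q)\<^sub>n\<close>
  removes the Gaussian coefficients, so \<open>A (q; q)\<^sub>n\<close> is the theta sum; and \<open>A B (q; q)\<^sub>n\<close>
  is \<open>(q; q)\<^bsub>2n\<^esub>\<close>, which is congruent to \<open>(q; q)\<^sub>n\<close>.
\<close>

lemma Gauss_theta_mod:
  fixes q :: "'a::comm_ring_1"
  shows "q ^ Suc n dvd qpoch q n - (\<Prod>i=1..n. 1 + q ^ i) * theta q n"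
proof -
  define A where "A = (\<Prod>i<n. 1 - q ^ (2 * i + 1))"
  define B where "B = (\<Prod>i=1..n. 1 + q ^ i)"
  have "A * qpoch q n - theta q n
      = (\<Sum>k\<le>2 * n. (- 1) ^ (k + n) * (q ^ sqdist k n * (qbinom q (2 * n) k * qpoch q n - 1)))"
    unfolding A_def finite_Gauss_theta[symmetric] theta_centered
    by (simp add: sum_distrib_left sum_distrib_right sum_subtractf algebra_simps)
  then have 1: "q ^ Suc n dvd A * qpoch q n - theta q n"
    by (auto intro!: dvd_sum dvd_mult qpoch_times_central_qbinom simp del: power_Suc)
  have "qpoch q (2 * n) - qpoch q n = qpoch q n * ((\<Prod>i=Suc n..2 * n. 1 - q ^ i) - 1)"
    using qpoch_split[of n "2 * n" q] by (simp add: algebra_simps)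
  then have 2: "q ^ Suc n dvd qpoch q (2 * n) - qpoch q n"
    by (auto intro!: dvd_mult power_dvd_prod_minus_one simp del: power_Suc)
  have "qpoch q n - B * theta q n = B * (A * qpoch q n - theta q n) - (qpoch q (2 * n) - qpoch q n)"
    unfolding qpoch_even_odd A_def[symmetric] B_def[symmetric] by (simp add: algebra_simps)
  then show ?thesis
    unfolding B_def[symmetric] using dvd_diff[OF dvd_mult[OF 1] 2] by (simp only:)
qed

section \<open>Generating functions of multisets\<close>

definition weighted_msets :: "('k \<Rightarrow> nat) \<Rightarrow> 'k set \<Rightarrow> nat \<Rightarrow> 'k multiset set" where
  "weighted_msets w S n = {M. set_mset M \<subseteq> S \<and> (\<Sum>x\<in>#M. w x) = n}"

definition mset_gf :: "('k \<Rightarrow> nat) \<Rightarrow> ('k \<Rightarrow> int) \<Rightarrow> 'k set \<Rightarrow> int fps" where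
  "mset_gf w c S = Abs_fps (\<lambda>n. \<Sum>M\<in>weighted_msets w S n. \<Prod>x\<in>#M. c x)"

lemma finite_weighted_msets:
  assumes "finite S" "\<And>x. x \<in> S \<Longrightarrow> 0 < w x"
  shows "finite (weighted_msets w S n)"
proof -
  have "weighted_msets w S n \<subseteq> (\<Union>k\<le>n. multisets_of_size S k)"
  proof
    fix M assume M: "M \<in> weighted_msets w S n"
    have "(\<Sum>x\<in>#M. 1) \<le> (\<Sum>x\<in>#M. w x)"
      by (rule sum_mset_mono) (use M assms in \<open>auto simp: Suc_le_eq weighted_msets_def\<close>)
    then show "M \<in> (\<Union>k\<le>n. multisets_of_size S k)"
      using M by (auto simp: weighted_msets_def multisets_of_size_def)
  qed
  then show ?thesis
    by (rule finite_subset) (simp add: finite_multisets_of_size assms)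
qed

text \<open>
  A multiset over \<open>insert x S\<close> either avoids \<open>x\<close>, or loses the weight of \<open>x\<close> and the factor
  \<open>c x\<close> when one copy of \<open>x\<close> is removed. This is the geometric series for the multiplicity of
  \<open>x\<close> in the form of a recurrence.
\<close>

lemma mset_gf_insert:
  assumes "finite S" "\<And>y. y \<in> insert x S \<Longrightarrow> 0 < w y" "x \<notin> S"
  shows "(1 - fps_const (c x) * fps_X ^ w x) * mset_gf w c (insert x S) = mset_gf w c S"
proof (rule fps_ext)
  fix n
  let ?W = "weighted_msets w"
  let ?c = "\<lambda>M. \<Prod>y\<in>#M. c y"
  define W where "W = {M \<in> ?W (insert x S) n. x \<in># M}"
  have fin: "finite (?W (insert x S) m)" for m
    using assms by (intro finite_weighted_msets) auto
  have split: "?W (insert x S) n = ?W S n \<union> W" "?W S n \<inter> W = {}"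
    using assms(3) by (auto simp: weighted_msets_def W_def)
  have "(\<Sum>M\<in>?W (insert x S) n. ?c M) = (\<Sum>M\<in>?W S n. ?c M) + (\<Sum>M\<in>W. ?c M)"
    using fin[of n] unfolding split(1) by (intro sum.union_disjoint split(2)) auto
  moreover have "(\<Sum>M\<in>W. ?c M) = (if n < w x then 0 else c x * (\<Sum>M\<in>?W (insert x S) (n - w x). ?c M))"
  proof (cases "n < w x")
    case True
    have "W = {}"
    proof (rule equals0I)
      fix M assume M: "M \<in> W"
      then obtain M' where "M = add_mset x M'" by (auto simp: W_def dest: multi_member_split)
      with M True show False by (auto simp: W_def weighted_msets_def)
    qed
    with True show ?thesis by simp
  next
    case False
    have "(\<Sum>M\<in>W. ?c M) = (\<Sum>M\<in>?W (insert x S) (n - w x). c x * ?c M)"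
      by (rule sum.reindex_bij_witness[of _ "add_mset x" "\<lambda>M. M - {#x#}"])
        (use False in \<open>auto simp: W_def weighted_msets_def dest!: multi_member_split\<close>)
    then show ?thesis using False by (simp add: sum_distrib_left)
  qed
  ultimately show "fps_nth ((1 - fps_const (c x) * fps_X ^ w x) * mset_gf w c (insert x S)) n
      = fps_nth (mset_gf w c S) n"
    by (simp add: mset_gf_def left_diff_distrib mult.assoc fps_X_power_mult_nth)
qed

lemma mset_gf_mult_prod:
  assumes "finite S" "\<And>x. x \<in> S \<Longrightarrow> 0 < w x"
  shows "mset_gf w c S * (\<Prod>x\<in>S. 1 - fps_const (c x) * fps_X ^ w x) = 1"
  using assms
proof (induction S rule: finite_induct)
  case empty
  have "weighted_msets w {} n = (if n = 0 then {{#}} else {})" for n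
    by (auto simp: weighted_msets_def)
  then show ?case
    by (auto simp: mset_gf_def fps_eq_iff)
next
  case (insert x S)
  have "mset_gf w c (insert x S) * (\<Prod>y\<in>insert x S. 1 - fps_const (c y) * fps_X ^ w y)
      = ((1 - fps_const (c x) * fps_X ^ w x) * mset_gf w c (insert x S))
        * (\<Prod>y\<in>S. 1 - fps_const (c y) * fps_X ^ w y)"
    using insert.hyps by (simp add: ac_simps)
  also have "\<dots> = mset_gf w c S * (\<Prod>y\<in>S. 1 - fps_const (c y) * fps_X ^ w y)"
    using insert by (subst mset_gf_insert) auto
  also have "\<dots> = 1" using insert by simp
  finally show ?case .
qed

section \<open>Signed enumeration of partitions by the number of even parts\<close>

text \<open>
  The admissible kinds of parts of size at most \<open>2 n\<close>. The bound makes the set finite, and it is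
  even so that exactly \<open>n\<close> kinds of even parts occur, as many as there are factors in
  \<open>(q; q)\<^sub>n\<close> for \<open>q = x\<^sup>2\<close>.
\<close>

definition parts_upto :: "nat \<Rightarrow> (nat \<times> color) set" where
  "parts_upto n = {p. 0 < fst p \<and> fst p \<le> 2 * n \<and> (even (fst p) \<longrightarrow> snd p = Blue)}"

lemma finite_parts_upto: "finite (parts_upto n)"
proof (rule finite_subset)
  show "parts_upto n \<subseteq> {..2 * n} \<times> {Red, Blue}"
    by (auto simp: parts_upto_def) (metis color.exhaust)
qed simp

lemma finite_even_blue_partitions: "finite (even_blue_partitions n)"
  unfolding even_blue_partitions_def
  by (rule finite_subset[OF _ finite_two_color_partitions[of n]]) auto

lemma weighted_msets_parts_upto:
  assumes "n \<le> 2 * m"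
  shows "weighted_msets fst (parts_upto m) n = even_blue_partitions n"
proof -
  have "fst p \<le> 2 * m" if "p \<in># \<pi>" "(\<Sum>x\<in>#\<pi>. fst x) = n" for p and \<pi> :: two_color_partition
    using that assms by (auto dest!: multi_member_split)
  then show ?thesis
    by (auto simp: weighted_msets_def parts_upto_def even_blue_partitions_def two_color_partitions_def)
qed

definition even_sign :: "nat \<times> color \<Rightarrow> int" where
  "even_sign p = (if even (fst p) then - 1 else 1)"

lemma prod_even_sign: "(\<Prod>p\<in>#\<pi>. even_sign p) = (- 1) ^ size {#p \<in># \<pi>. even (fst p)#}"
  by (induction \<pi>) (auto simp: even_sign_def)

lemma prod_parts_upto:
  fixes f :: "nat \<times> color \<Rightarrow> 'b::comm_monoid_mult"
  shows "(\<Prod>p\<in>parts_upto n. f p)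
    = (\<Prod>p\<in>{p\<in>parts_upto n. odd (fst p)}. f p) * (\<Prod>i=1..n. f (2 * i, Blue))"
proof -
  have "parts_upto n = {p\<in>parts_upto n. odd (fst p)} \<union> {p\<in>parts_upto n. even (fst p)}"
    by auto
  then have "(\<Prod>p\<in>parts_upto n. f p)
      = (\<Prod>p\<in>{p\<in>parts_upto n. odd (fst p)}. f p) * (\<Prod>p\<in>{p\<in>parts_upto n. even (fst p)}. f p)"
    using finite_parts_upto[of n] by (subst prod.union_disjoint[symmetric]) auto
  also have "(\<Prod>p\<in>{p\<in>parts_upto n. even (fst p)}. f p) = (\<Prod>i=1..n. f (2 * i, Blue))"
    by (rule prod.reindex_bij_witness[of _ "\<lambda>i. (2 * i, Blue)" "\<lambda>p. fst p div 2"])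
      (auto simp: parts_upto_def)
  finally show ?thesis .
qed

text \<open>
  With \<open>D\<close> for the common factor of the odd parts, \<open>P\<close> is inverse to \<open>D (q; q)\<^sub>n\<close> and \<open>Q\<close>
  is inverse to \<open>D B\<close>, where \<open>q = x\<^sup>2\<close>. Therefore \<open>Q - theta q n * P\<close> is \<open>P Q D\<close> times the
  difference that Gauss's identity makes divisible by \<open>q\<^bsup>n+1\<^esup>\<close>.
\<close>

lemma signed_gf_mod:
  fixes n :: nat
  defines "P \<equiv> mset_gf fst (\<lambda>_. 1) (parts_upto n)" and "Q \<equiv> mset_gf fst even_sign (parts_upto n)"
  shows "(fps_X\<^sup>2) ^ Suc n dvd Q - theta (fps_X\<^sup>2) n * P"
proof -
  define q :: "int fps" where "q = fps_X\<^sup>2"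
  define D :: "int fps" where "D = (\<Prod>p\<in>{p\<in>parts_upto n. odd (fst p)}. 1 - fps_X ^ fst p)"
  define B where "B = (\<Prod>i=1..n. 1 + q ^ i)"
  have pos: "0 < fst p" if "p \<in> parts_upto n" for p
    using that by (simp add: parts_upto_def)
  have "P * (\<Prod>p\<in>parts_upto n. 1 - fps_X ^ fst p) = 1"
    using mset_gf_mult_prod[where w = fst and c = "\<lambda>_. 1", OF finite_parts_upto[of n] pos] by (simp add: P_def)
  then have 1: "P * (D * qpoch q n) = 1"
    unfolding prod_parts_upto by (simp add: D_def qpoch_def q_def power_mult)
  have "Q * (\<Prod>p\<in>parts_upto n. 1 - fps_const (even_sign p) * fps_X ^ fst p) = 1"
    using mset_gf_mult_prod[where w = fst and c = even_sign, OF finite_parts_upto[of n] pos] by (simp add: Q_def)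
  then have 2: "Q * (D * B) = 1"
    unfolding prod_parts_upto
    by (simp add: D_def B_def q_def even_sign_def power_mult fps_const_neg[symmetric] del: fps_const_neg)
  have "Q - theta q n * P = Q * (P * (D * qpoch q n)) - (Q * (D * B)) * (theta q n * P)"
    unfolding 1 2 by simp
  also have "\<dots> = Q * P * D * (qpoch q n - B * theta q n)"
    by (simp add: algebra_simps)
  finally show ?thesis
    unfolding q_def[symmetric] by (simp only:) (use Gauss_theta_mod[of q n] in \<open>simp add: B_def\<close>)
qed

text \<open>
  The coefficient of \<open>x\<^sup>n\<close> in the congruence between \<open>Q\<close> and \<open>theta q n * P\<close>, whose modulus
  \<open>x\<^bsup>2n+2\<^esup>\<close> lies beyond it. For this coefficient the bound \<open>2 n\<close> on the parts is no restriction.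
\<close>

lemma signed_count:
  "(\<Sum>\<pi>\<in>even_blue_partitions n. (- 1) ^ size {#p \<in># \<pi>. even (fst p)#})
    = int (card (even_blue_partitions n))
      + 2 * (\<Sum>j=1..n. (- 1) ^ j * (if 2 * (j * j) \<le> n then int (card (even_blue_partitions (n - 2 * (j * j)))) else 0))"
proof -
  define P where "P = mset_gf fst (\<lambda>_. 1) (parts_upto n)"
  define Q where "Q = mset_gf fst even_sign (parts_upto n)"
  have P: "fps_nth P m = int (card (even_blue_partitions m))" if "m \<le> n" for m
    using that by (simp add: P_def mset_gf_def weighted_msets_parts_upto)
  have Q: "fps_nth Q n = (\<Sum>\<pi>\<in>even_blue_partitions n. (- 1) ^ size {#p \<in># \<pi>. even (fst p)#})"
    by (simp add: Q_def mset_gf_def weighted_msets_parts_upto prod_even_sign)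
  have "(fps_X ^ (2 * Suc n) :: int fps) dvd Q - theta (fps_X\<^sup>2) n * P"
    unfolding power_mult P_def Q_def by (rule signed_gf_mod)
  then obtain R where "Q - theta (fps_X\<^sup>2) n * P = fps_X ^ (2 * Suc n) * R" by (elim dvdE)
  then have "fps_nth (Q - theta (fps_X\<^sup>2) n * P) n = 0"
    by (simp only: fps_X_power_mult_nth) simp
  then have "fps_nth Q n = fps_nth (theta (fps_X\<^sup>2) n * P) n" by simp
  also have "theta (fps_X\<^sup>2) n * P
      = P + fps_const 2 * (\<Sum>j=1..n. fps_const ((- 1) ^ j) * (fps_X ^ (2 * (j * j)) * P))"
    by (simp add: theta_def distrib_right sum_distrib_right power_mult mult.assoc numeral_fps_const
        flip: fps_const_power fps_const_neg)
  also have "fps_nth \<dots> n = fps_nth P n + 2 * (\<Sum>j=1..n. (- 1) ^ j * (if 2 * (j * j) \<le> n then fps_nth P (n - 2 * (j * j)) else 0))"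
    by (simp add: fps_sum_nth fps_X_power_mult_nth) (intro sum.cong, auto)
  finally show ?thesis
    unfolding Q by (simp add: P cong: if_cong)
qed

section \<open>Enumeration of partitions by the mex\<close>

definition staircase :: "nat \<Rightarrow> two_color_partition" where
  "staircase j = image_mset (\<lambda>i. (4 * i + 2, Blue)) (mset_set {..<j})"

lemma set_staircase: "set_mset (staircase j) = (\<lambda>i. (4 * i + 2, Blue)) ` {..<j}"
  by (simp add: staircase_def)

lemma sum_staircase: "(\<Sum>p\<in>#staircase j. fst p) = 2 * (j * j)"
proof -
  have "(\<Sum>i<j. 4 * i + 2) = 2 * (j * j)" for j :: nat
    by (induction j) (auto simp: algebra_simps)
  then show ?thesis
    by (simp add: staircase_def image_mset.compositionality comp_def sum_unfold_sum_mset)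
qed

lemma staircase_subset_iff: "staircase j \<subseteq># \<pi> \<longleftrightarrow> (\<forall>i<j. (4 * i + 2, Blue) \<in># \<pi>)"
proof
  assume "staircase j \<subseteq># \<pi>"
  then have "set_mset (staircase j) \<subseteq> set_mset \<pi>" by (rule set_mset_mono)
  then show "\<forall>i<j. (4 * i + 2, Blue) \<in># \<pi>" by (auto simp: set_staircase)
next
  assume *: "\<forall>i<j. (4 * i + 2, Blue) \<in># \<pi>"
  have "staircase j = mset_set ((\<lambda>i. (4 * i + 2, Blue)) ` {..<j})"
    unfolding staircase_def by (rule image_mset_mset_set) (simp add: inj_on_def)
  also have "\<dots> \<subseteq># mset_set (set_mset \<pi>)"
    using * by (intro subset_imp_msubset_mset_set) auto
  also have "\<dots> \<subseteq># \<pi>" by (rule mset_set_set_mset_msubset)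
  finally show "staircase j \<subseteq># \<pi>" .
qed

text \<open>Removing one copy of the staircase is a bijection, and its weight is \<open>2 j\<^sup>2\<close>.\<close>

lemma card_containing_staircase:
  "card {\<pi> \<in> even_blue_partitions n. staircase j \<subseteq># \<pi>}
    = (if 2 * (j * j) \<le> n then card (even_blue_partitions (n - 2 * (j * j))) else 0)"
proof (cases "2 * (j * j) \<le> n")
  case True
  have "bij_betw (\<lambda>\<pi>. \<pi> + staircase j) (even_blue_partitions (n - 2 * (j * j)))
      {\<pi> \<in> even_blue_partitions n. staircase j \<subseteq># \<pi>}"
  proof (rule bij_betw_byWitness[where f' = "\<lambda>\<pi>. \<pi> - staircase j"])
    show "(\<lambda>\<pi>. \<pi> + staircase j) ` even_blue_partitions (n - 2 * (j * j))
        \<subseteq> {\<pi> \<in> even_blue_partitions n. staircase j \<subseteq># \<pi>}"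
      using True
      by (auto simp: even_blue_partitions_def two_color_partitions_def sum_staircase set_staircase)
    show "(\<lambda>\<pi>. \<pi> - staircase j) ` {\<pi> \<in> even_blue_partitions n. staircase j \<subseteq># \<pi>}
        \<subseteq> even_blue_partitions (n - 2 * (j * j))"
    proof clarify
      fix \<pi> assume \<pi>: "\<pi> \<in> even_blue_partitions n" "staircase j \<subseteq># \<pi>"
      then obtain \<rho> where \<rho>: "\<pi> = staircase j + \<rho>" by (auto simp: mset_subset_eq_exists_conv)
      show "\<pi> - staircase j \<in> even_blue_partitions (n - 2 * (j * j))"
        using \<pi>(1) unfolding \<rho>
        by (auto simp: even_blue_partitions_def two_color_partitions_def sum_staircase)
    qed
  qed auto
  then show ?thesis using True by (simp add: bij_betw_same_card)
next
  case False
  have "{\<pi> \<in> even_blue_partitions n. staircase j \<subseteq># \<pi>} = {}"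
    using False
    by (auto simp: mset_subset_eq_exists_conv even_blue_partitions_def two_color_partitions_def sum_staircase)
  then show ?thesis using False by (simp only: card.empty if_False)
qed

lemma sum_alternating_upto: "(\<Sum>j=1..k. (- 1 :: int) ^ j) = (if odd k then - 1 else 0)"
  by (induction k) auto

text \<open>
  If the mex is \<open>4 k + 2\<close>, the staircases contained in the partition are exactly those of length
  \<open>j \<le> k\<close>, so the sum is an alternating sum of \<open>k\<close> signs. Since \<open>2 k\<^sup>2 \<le> n\<close>, no staircase
  is longer than \<open>n\<close>, and the range of \<open>j\<close> need not depend on the partition.
\<close>

lemma indicator_mex:
  assumes "\<pi> \<in> even_blue_partitions n"
  shows "(if mex 4 2 \<pi> Blue mod 8 = 6 then 1 else 0 :: int)
    = - (\<Sum>j=1..n. (- 1) ^ j * (if staircase j \<subseteq># \<pi> then 1 else 0))"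
proof -
  define m where "m = mex 4 2 \<pi> Blue"
  have m: "0 < m \<and> m mod 4 = 2 mod 4 \<and> (m, Blue) \<notin># \<pi>"
    unfolding m_def mex_def by (rule LeastI_ex) (rule mex_exists, simp)
  define k where "k = m div 4"
  have "m mod 4 = 2" using m by simp
  then have mk: "m = 4 * k + 2" unfolding k_def by presburger
  have below: "(4 * i + 2, Blue) \<in># \<pi>" if "i < k" for i
  proof (rule ccontr)
    assume "(4 * i + 2, Blue) \<notin># \<pi>"
    then have "m \<le> 4 * i + 2"
      unfolding m_def mex_def by (intro Least_le) (simp del: add_2_eq_Suc')
    with that mk show False by simp
  qed
  have iff: "staircase j \<subseteq># \<pi> \<longleftrightarrow> j \<le> k" for j
  proof
    assume "staircase j \<subseteq># \<pi>"
    then show "j \<le> k"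
      using m unfolding staircase_subset_iff mk by (metis not_le)
  qed (use below in \<open>auto simp: staircase_subset_iff\<close>)
  have "k \<le> n"
  proof -
    obtain \<rho> where "\<pi> = staircase k + \<rho>"
      using iff[of k] by (auto simp: mset_subset_eq_exists_conv)
    then have "2 * (k * k) \<le> n"
      using assms by (auto simp: even_blue_partitions_def two_color_partitions_def sum_staircase)
    then show ?thesis using le_square[of k] by linarith
  qed
  have "(\<Sum>j=1..n. (- 1 :: int) ^ j * (if staircase j \<subseteq># \<pi> then 1 else 0)) = (\<Sum>j=1..k. (- 1) ^ j)"
    using \<open>k \<le> n\<close> by (intro sum.mono_neutral_cong_right) (auto simp: iff)
  moreover have "m mod 8 = 6 \<longleftrightarrow> odd k"
    unfolding mk by presburger
  ultimately show ?thesis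
    unfolding m_def[symmetric] sum_alternating_upto by (simp only:) simp
qed

lemma pbar_alternating_sum:
  "int (pbar42_blue n) = - (\<Sum>j=1..n. (- 1) ^ j *
      (if 2 * (j * j) \<le> n then int (card (even_blue_partitions (n - 2 * (j * j)))) else 0))"
proof -
  let ?F = "even_blue_partitions n"
  have card: "int (card {\<pi> \<in> ?F. R \<pi>}) = (\<Sum>\<pi>\<in>?F. if R \<pi> then 1 else 0)" for R
    using finite_even_blue_partitions[of n] by (simp add: sum.If_cases Int_def)
  have "int (pbar42_blue n)
      = (\<Sum>\<pi>\<in>?F. - (\<Sum>j=1..n. (- 1) ^ j * (if staircase j \<subseteq># \<pi> then 1 else 0)))"
    unfolding pbar42_blue_def card by (intro sum.cong refl indicator_mex)
  also have "\<dots> = - (\<Sum>j=1..n. (- 1) ^ j * int (card {\<pi> \<in> ?F. staircase j \<subseteq># \<pi>}))"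
    unfolding card by (subst sum_negf, subst sum.swap) (simp add: sum_distrib_left)
  finally show ?thesis
    unfolding card_containing_staircase by (simp add: if_distrib cong: if_cong)
qed

theorem theorem4:
  fixes n :: nat
  shows "F3 n = pbar42_blue n"
proof -
  let ?F = "even_blue_partitions n"
  let ?e = "\<lambda>\<pi>. size {#p \<in># \<pi>. even (fst p)#}"
  have "(\<Sum>\<pi>\<in>?F. (- 1 :: int) ^ ?e \<pi>) = (\<Sum>\<pi>\<in>?F. 1 - 2 * (if odd (?e \<pi>) then 1 else 0))"
    by (intro sum.cong) auto
  also have "\<dots> = int (card ?F) - 2 * int (F3 n)"
    using finite_even_blue_partitions[of n]
    by (simp add: F3_def sum_subtractf sum.If_cases Int_def flip: sum_distrib_left)
  finally have "int (F3 n) = int (pbar42_blue n)"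
    using signed_count[of n] pbar_alternating_sum[of n] by simp
  then show ?thesis by simp
qed

end
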